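(* Let $T=M_wEM_u$ be a bounded WCT operator on the Orlicz space $L^\Phi(\Sigma)$. Then $\mathcal{R}(T^2)\cap\mathcal{N}(T^m)=\{0\}$ for every $m\ge1$. Also, if $E(wu)$ is bounded away from zero, then $L^\Phi(\mu)=\mathcal{R}(T^n)+\mathcal{N}(T^2)$ for some (equivalently, for all) $n\ge 1$.
   Context: $(X,\Sigma,\mu)$ is a complete $\sigma$-finite measure space; functions are complex-valued, identified when equal $\mu$-a.e. A Young function is a convex even function $\Phi:\mathbb{R}\to[0,\infty]$ with $\Phi(0)=0$, neither identically $0$ nor identically $\infty$ on $(0,\infty)$, and left-continuous at $b_\Phi=\sup\{x>0:\Phi(x)<\infty\}$. For a measurable function $f$, $\Phi(f)$ means $\Phi(|f|)$. $\Phi$ is a Young function and $L^\Phi(\mu)=L^\Phi(\Sigma)=\{f \text{ measurable}: \exists k>0,\ \int_X\Phi(kf)\,d\mu<\infty\}$ is the Orlicz space, a Banach space with norm $N_\Phi(f)=\inf\{k>0:\int_X\Phi(f/k)\,d\mu\le1\}$. $\mathcal{A}\subseteq\Sigma$ is a sub-$\sigma$-algebra such that $\mu|_{\mathcal A}$ is $\sigma$-finite, and $E=E^{\mathcal A}$ is the conditional expectation: $E(f)$ is the unique $\mathcal A$-measurable function with $\int_A f\,d\mu=\int_A E(f)\,d\mu$ for $A\in\mathcal A$, defined for $f\ge0$ and extended by linearity to measurable $f$ with $E(|f|)<\infty$ a.e. For measurable $u,w:X\to\mathbb{C}$, the WCT (weighted conditional type) operator $T=M_wEM_u$ is $T(f)=wE(uf)$,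 where it is understood that $E(uw)$ and $E(uf)$, $f\in L^\Phi(\mu)$, are defined. $E(wu)$ is bounded away from zero if there is $\delta>0$ with $|E(wu)|\ge\delta$ $\mu$-a.e. $\mathcal{N}(S)$ and $\mathcal{R}(S)$ denote the null space and range of $S$. *)

theory Defs
  imports "HOL-Probability.Probability"
begin

text \<open>
  Functions are identified when equal almost everywhere. Instead of passing to a quotient type,
  every subset of the Orlicz space below is a set of representatives that is closed under
  almost-everywhere equality; such sets correspond one-to-one to sets of equivalence classes,
  compatibly with intersection and with the pointwise sum of sets.
\<close>

subsection \<open>Young functions and Orlicz spaces\<close>

text \<open>In \<open>ennreal\<close> we have \<open>0 * \<infinity> = 0\<close>, so the convexity inequality is also correct at
  the endpoints \<open>t = 0\<close> and \<open>t = 1\<close>.\<close>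

definition ennreal_convex :: "(real \<Rightarrow> ennreal) \<Rightarrow> bool" where
  "ennreal_convex \<Phi> \<longleftrightarrow>
     (\<forall>x y t. 0 \<le> t \<and> t \<le> 1 \<longrightarrow>
        \<Phi> ((1 - t) * x + t * y) \<le> ennreal (1 - t) * \<Phi> x + ennreal t * \<Phi> y)"

definition young_b :: "(real \<Rightarrow> ennreal) \<Rightarrow> ereal" where
  "young_b \<Phi> = (SUP x\<in>{x. 0 < x \<and> \<Phi> x < \<infinity>}. ereal x)"

text \<open>Left-continuity at \<open>young_b \<Phi>\<close> is a condition only when that supremum is finite.\<close>

definition young_function :: "(real \<Rightarrow> ennreal) \<Rightarrow> bool" where
  "young_function \<Phi> \<longleftrightarrow>
     ennreal_convex \<Phi> \<and> (\<forall>x. \<Phi> (- x) = \<Phi> x) \<and> \<Phi> 0 = 0 \<and>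
     (\<exists>x>0. \<Phi> x \<noteq> 0) \<and> (\<exists>x>0. \<Phi> x \<noteq> \<infinity>) \<and>
     (\<forall>b. young_b \<Phi> = ereal b \<longrightarrow> continuous (at_left b) \<Phi>)"

definition orlicz_space :: "'a measure \<Rightarrow> (real \<Rightarrow> ennreal) \<Rightarrow> ('a \<Rightarrow> complex) set" where
  "orlicz_space M \<Phi> =
     {f \<in> borel_measurable M. \<exists>k>0. (\<integral>\<^sup>+ x. \<Phi> (cmod (of_real k * f x)) \<partial>M) < \<infinity>}"

definition orlicz_norm :: "'a measure \<Rightarrow> (real \<Rightarrow> ennreal) \<Rightarrow> ('a \<Rightarrow> complex) \<Rightarrow> real" where
  "orlicz_norm M \<Phi> f = Inf {k. 0 < k \<and> (\<integral>\<^sup>+ x. \<Phi> (cmod (f x / of_real k)) \<partial>M) \<le> 1}"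

subsection \<open>Conditional expectation of complex functions\<close>

text \<open>
  The sub-\<open>\<sigma>\<close>-algebra is \<open>sets F\<close>; the measure carried by \<open>F\<close> itself is irrelevant.
  No integrability is required: \<open>real_cond_exp\<close> is the difference of the conditional expectations
  of the positive and the negative part, which is meaningful as soon as the conditional
  expectation of the modulus is finite almost everywhere.
\<close>

definition complex_cond_exp :: "'a measure \<Rightarrow> 'a measure \<Rightarrow> ('a \<Rightarrow> complex) \<Rightarrow> 'a \<Rightarrow> complex" where
  "complex_cond_exp M F f =
     (\<lambda>x. Complex (real_cond_exp M F (\<lambda>y. Re (f y)) x) (real_cond_exp M F (\<lambda>y. Im (f y)) x))"

definition cond_exp_defined :: "'a measure \<Rightarrow> 'a measure \<Rightarrow> ('a \<Rightarrow> complex) \<Rightarrow> bool" where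
  "cond_exp_defined M F f \<longleftrightarrow>
     f \<in> borel_measurable M \<and> (AE x in M. nn_cond_exp M F (\<lambda>y. ennreal (cmod (f y))) x < \<infinity>)"

subsection \<open>Weighted conditional type operators\<close>

definition wct :: "'a measure \<Rightarrow> 'a measure \<Rightarrow> ('a \<Rightarrow> complex) \<Rightarrow> ('a \<Rightarrow> complex)
    \<Rightarrow> ('a \<Rightarrow> complex) \<Rightarrow> 'a \<Rightarrow> complex" where
  "wct M F w u f = (\<lambda>x. w x * complex_cond_exp M F (\<lambda>y. u y * f y) x)"

definition wct_defined :: "'a measure \<Rightarrow> 'a measure \<Rightarrow> (real \<Rightarrow> ennreal) \<Rightarrow>
    ('a \<Rightarrow> complex) \<Rightarrow> ('a \<Rightarrow> complex) \<Rightarrow> bool" where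
  "wct_defined M F \<Phi> w u \<longleftrightarrow>
     w \<in> borel_measurable M \<and> u \<in> borel_measurable M \<and>
     cond_exp_defined M F (\<lambda>x. u x * w x) \<and>
     (\<forall>f\<in>orlicz_space M \<Phi>. cond_exp_defined M F (\<lambda>x. u x * f x))"

subsection \<open>Operators on Orlicz spaces\<close>

text \<open>Linearity is not part of this definition; it holds automatically (almost everywhere)
  for the operators \<open>wct M F w u\<close>.\<close>

definition bounded_on_orlicz :: "'a measure \<Rightarrow> (real \<Rightarrow> ennreal) \<Rightarrow>
    (('a \<Rightarrow> complex) \<Rightarrow> 'a \<Rightarrow> complex) \<Rightarrow> bool" where
  "bounded_on_orlicz M \<Phi> S \<longleftrightarrow>
     (\<forall>f\<in>orlicz_space M \<Phi>. S f \<in> orlicz_space M \<Phi>) \<and>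
     (\<exists>C. \<forall>f\<in>orlicz_space M \<Phi>. orlicz_norm M \<Phi> (S f) \<le> C * orlicz_norm M \<Phi> f)"

definition orlicz_zero :: "'a measure \<Rightarrow> ('a \<Rightarrow> complex) set" where
  "orlicz_zero M = {f \<in> borel_measurable M. AE x in M. f x = 0}"

definition null_space :: "'a measure \<Rightarrow> (real \<Rightarrow> ennreal) \<Rightarrow>
    (('a \<Rightarrow> complex) \<Rightarrow> 'a \<Rightarrow> complex) \<Rightarrow> ('a \<Rightarrow> complex) set" where
  "null_space M \<Phi> S = {f \<in> orlicz_space M \<Phi>. AE x in M. S f x = 0}"

definition range_space :: "'a measure \<Rightarrow> (real \<Rightarrow> ennreal) \<Rightarrow>
    (('a \<Rightarrow> complex) \<Rightarrow> 'a \<Rightarrow> complex) \<Rightarrow> ('a \<Rightarrow> complex) set" where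
  "range_space M \<Phi> S =
     {g \<in> orlicz_space M \<Phi>. \<exists>f\<in>orlicz_space M \<Phi>. AE x in M. g x = S f x}"

definition fun_set_sum :: "('a \<Rightarrow> complex) set \<Rightarrow> ('a \<Rightarrow> complex) set \<Rightarrow> ('a \<Rightarrow> complex) set" where
  "fun_set_sum A B = {(\<lambda>x. g x + h x) | g h. g \<in> A \<and> h \<in> B}"

definition bounded_away_from_zero :: "'a measure \<Rightarrow> ('a \<Rightarrow> complex) \<Rightarrow> bool" where
  "bounded_away_from_zero M f \<longleftrightarrow> (\<exists>\<delta>>0. AE x in M. \<delta> \<le> cmod (f x))"

end

theory Submission
  imports Defs
begin

text \<open>
  Everything rests on one formula. Put \<open>v = E(w u)\<close>. Since \<open>E(u f)\<close> and \<open>v\<close> are measurable for the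
  subalgebra, they can be pulled out of \<open>E\<close>, so the powers of \<open>T = M\<^sub>w E M\<^sub>u\<close> act almost everywhere by
  \<open>T ^ (n + 1) f = w * v ^ n * E(u f)\<close> (lemma \<open>funpow_eq\<close>). The powers of \<open>T\<close> thus differ only by
  multiplication with powers of the one function \<open>v\<close>, and the claims become pointwise:

  \<^item> If \<open>g = T\<^sup>2 f = w v E(u f)\<close> and \<open>T ^ m g = w v ^ (m + 1) E(u f) = 0\<close>, then at almost every point
    one of the three factors \<open>w\<close>, \<open>v\<close>, \<open>E(u f)\<close> is zero, hence so is \<open>g\<close>.
  \<^item> A decomposition \<open>f = T ^ n g + h\<close> with \<open>T\<^sup>2 h = 0\<close> amounts to solving \<open>T\<^sup>2 f = T ^ (n + 2) g\<close>
    (lemma \<open>orlicz_eq_range_plus_null_iff\<close>). If \<open>v\<close> is bounded away from zero, then \<open>g = f / v\<close> is a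
    solution for \<open>n = 1\<close>, and it lies in the Orlicz space because it is dominated by a multiple
    of \<open>f\<close>.
  \<^item> Solvability for some exponent \<open>n \<ge> 1\<close> gives solvability for exponent one, and this one can be
    iterated to reach every exponent.

  Two ingredients need work. The products \<open>u f\<close> are usually not integrable, only
  \<open>E \<bar>u f\<bar> < \<infinity>\<close> holds almost everywhere, so additivity and the pull-out property of the
  conditional expectation have to be established in that generality. And the Orlicz space has to be
  closed under sums and under domination, which follows from convexity and monotonicity of the
  Young function.
\<close>

section \<open>Conditional expectation without integrability\<close>

context sigma_finite_subalgebra
begin

lemma nn_cond_exp_finite_mono:
  assumes "AE x in M. nn_cond_exp M F g x < \<infinity>" "\<And>x. f x \<le> g x"
    and [measurable]: "f \<in> borel_measurable M" "g \<in> borel_measurable M"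
  shows "AE x in M. nn_cond_exp M F f x < \<infinity>"
proof -
  have "AE x in M. nn_cond_exp M F f x \<le> nn_cond_exp M F g x"
    by (rule nn_cond_exp_mono) (auto simp: assms(2))
  with assms(1) show ?thesis
    by eventually_elim (rule order.strict_trans1)
qed

text \<open>
  The value of \<^const>\<open>real_cond_exp\<close> may be computed from any representation of \<open>f\<close> as a difference
  \<open>a - b\<close>, not only from the canonical one by positive and negative part. The equation is written
  with sums because subtraction in \<^typ>\<open>ennreal\<close> is truncated.
\<close>
lemma real_cond_exp_eq_difference:
  fixes f :: "'a \<Rightarrow> real" and a b :: "'a \<Rightarrow> ennreal"
  assumes eq: "\<And>x. ennreal (f x) + b x = ennreal (- f x) + a x"
    and [measurable]: "f \<in> borel_measurable M" "a \<in> borel_measurable M" "b \<in> borel_measurable M"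
    and f: "AE x in M. nn_cond_exp M F (\<lambda>y. ennreal \<bar>f y\<bar>) x < \<infinity>"
    and a: "AE x in M. nn_cond_exp M F a x < \<infinity>" and b: "AE x in M. nn_cond_exp M F b x < \<infinity>"
  shows "AE x in M. real_cond_exp M F f x =
    enn2real (nn_cond_exp M F a x) - enn2real (nn_cond_exp M F b x)"
proof -
  have p: "AE x in M. nn_cond_exp M F (\<lambda>y. ennreal (f y)) x < \<infinity>"
    by (rule nn_cond_exp_finite_mono[OF f]) (auto intro!: ennreal_leI)
  have n: "AE x in M. nn_cond_exp M F (\<lambda>y. ennreal (- f y)) x < \<infinity>"
    by (rule nn_cond_exp_finite_mono[OF f]) (auto intro!: ennreal_leI)
  have 1: "AE x in M. nn_cond_exp M F (\<lambda>y. ennreal (f y)) x + nn_cond_exp M F b x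
      = nn_cond_exp M F (\<lambda>y. ennreal (f y) + b y) x"
    by (rule nn_cond_exp_sum) auto
  have 2: "AE x in M. nn_cond_exp M F (\<lambda>y. ennreal (- f y)) x + nn_cond_exp M F a x
      = nn_cond_exp M F (\<lambda>y. ennreal (- f y) + a y) x"
    by (rule nn_cond_exp_sum) auto
  from 1 2 p n a b show ?thesis
  proof eventually_elim
    case (elim x)
    then have "nn_cond_exp M F (\<lambda>y. ennreal (f y)) x + nn_cond_exp M F b x
      = nn_cond_exp M F (\<lambda>y. ennreal (- f y)) x + nn_cond_exp M F a x"
      by (simp add: eq)
    then have "enn2real (nn_cond_exp M F (\<lambda>y. ennreal (f y)) x) + enn2real (nn_cond_exp M F b x)
      = enn2real (nn_cond_exp M F (\<lambda>y. ennreal (- f y)) x) + enn2real (nn_cond_exp M F a x)"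
      using elim(3-6) by (metis enn2real_plus infinity_ennreal_def)
    then show ?case
      by (simp add: real_cond_exp_def)
  qed
qed

lemma nn_cond_exp_norm_add_finite:
  fixes f g :: "'a \<Rightarrow> 'b::{real_normed_vector, second_countable_topology}"
  assumes [measurable]: "f \<in> borel_measurable M" "g \<in> borel_measurable M"
    and f: "AE x in M. nn_cond_exp M F (\<lambda>y. ennreal (norm (f y))) x < \<infinity>"
    and g: "AE x in M. nn_cond_exp M F (\<lambda>y. ennreal (norm (g y))) x < \<infinity>"
  shows "AE x in M. nn_cond_exp M F (\<lambda>y. ennreal (norm (f y + g y))) x < \<infinity>"
proof (rule nn_cond_exp_finite_mono)
  have "AE x in M. nn_cond_exp M F (\<lambda>y. ennreal (norm (f y))) x + nn_cond_exp M F (\<lambda>y. ennreal (norm (g y))) x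
      = nn_cond_exp M F (\<lambda>y. ennreal (norm (f y)) + ennreal (norm (g y))) x"
    by (rule nn_cond_exp_sum) auto
  with f g show "AE x in M. nn_cond_exp M F (\<lambda>y. ennreal (norm (f y)) + ennreal (norm (g y))) x < \<infinity>"
  proof eventually_elim
    case (elim x)
    from elim(1,2) show ?case by (simp flip: elim(3))
  qed
  show "ennreal (norm (f x + g x)) \<le> ennreal (norm (f x)) + ennreal (norm (g x))" for x
    by (simp add: norm_triangle_ineq flip: ennreal_plus)
qed auto

lemma nn_cond_exp_norm_mult_finite:
  fixes f h :: "'a \<Rightarrow> 'b::{real_normed_div_algebra, second_countable_topology}"
  assumes [measurable]: "h \<in> borel_measurable F" "f \<in> borel_measurable M"
    and f: "AE x in M. nn_cond_exp M F (\<lambda>y. ennreal (norm (f y))) x < \<infinity>"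
  shows "AE x in M. nn_cond_exp M F (\<lambda>y. ennreal (norm (h y * f y))) x < \<infinity>"
proof -
  have "AE x in M. ennreal (norm (h x)) * nn_cond_exp M F (\<lambda>y. ennreal (norm (f y))) x
      = nn_cond_exp M F (\<lambda>y. ennreal (norm (h y)) * ennreal (norm (f y))) x"
    by (rule nn_cond_exp_prod) auto
  with f show ?thesis
  proof eventually_elim
    case (elim x)
    from elim(1) show ?case
      by (simp add: norm_mult ennreal_mult ennreal_mult_less_top flip: elim(2))
  qed
qed

text \<open>
  The positive part of \<open>f + g\<close> is not the sum of the positive parts, but
  \<open>f + g = (f\<^sup>+ + g\<^sup>+) - (f\<^sup>- + g\<^sup>-)\<close> is a representation to which lemma \<open>real_cond_exp_eq_difference\<close> applies.
\<close>
lemma real_cond_exp_add_locally_finite: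
  fixes f g :: "'a \<Rightarrow> real"
  assumes [measurable]: "f \<in> borel_measurable M" "g \<in> borel_measurable M"
    and f: "AE x in M. nn_cond_exp M F (\<lambda>y. ennreal \<bar>f y\<bar>) x < \<infinity>"
    and g: "AE x in M. nn_cond_exp M F (\<lambda>y. ennreal \<bar>g y\<bar>) x < \<infinity>"
  shows "AE x in M. real_cond_exp M F (\<lambda>y. f y + g y) x = real_cond_exp M F f x + real_cond_exp M F g x"
proof -
  let ?E = "nn_cond_exp M F"
  have parts: "AE x in M. ?E (\<lambda>y. ennreal (f y)) x < \<infinity>" "AE x in M. ?E (\<lambda>y. ennreal (- f y)) x < \<infinity>"
    "AE x in M. ?E (\<lambda>y. ennreal (g y)) x < \<infinity>" "AE x in M. ?E (\<lambda>y. ennreal (- g y)) x < \<infinity>"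
    by (rule nn_cond_exp_finite_mono[OF f] nn_cond_exp_finite_mono[OF g];
        auto intro!: ennreal_leI)+
  have a: "AE x in M. ?E (\<lambda>y. ennreal (f y)) x + ?E (\<lambda>y. ennreal (g y)) x
      = ?E (\<lambda>y. ennreal (f y) + ennreal (g y)) x"
    by (rule nn_cond_exp_sum) auto
  have b: "AE x in M. ?E (\<lambda>y. ennreal (- f y)) x + ?E (\<lambda>y. ennreal (- g y)) x
      = ?E (\<lambda>y. ennreal (- f y) + ennreal (- g y)) x"
    by (rule nn_cond_exp_sum) auto
  have "AE x in M. real_cond_exp M F (\<lambda>y. f y + g y) x =
    enn2real (?E (\<lambda>y. ennreal (f y) + ennreal (g y)) x) -
    enn2real (?E (\<lambda>y. ennreal (- f y) + ennreal (- g y)) x)"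
  proof (rule real_cond_exp_eq_difference)
    fix x
    have pos: "ennreal r = ennreal (max 0 r)" for r :: real
      by (auto simp: max_def ennreal_neg)
    show "ennreal (f x + g x) + (ennreal (- f x) + ennreal (- g x)) =
      ennreal (- (f x + g x)) + (ennreal (f x) + ennreal (g x))"
      unfolding pos[of "f x + g x"] pos[of "- (f x + g x)"] pos[of "f x"] pos[of "- f x"]
        pos[of "g x"] pos[of "- g x"]
      by (simp add: max_def flip: ennreal_plus)
  next
    show "AE x in M. ?E (\<lambda>y. ennreal \<bar>f y + g y\<bar>) x < \<infinity>"
      using nn_cond_exp_norm_add_finite[of f g] f g by simp
    show "AE x in M. ?E (\<lambda>y. ennreal (f y) + ennreal (g y)) x < \<infinity>"
      using a parts(1,3)
    proof eventually_elim
      case (elim x)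
      from elim(2,3) show ?case by (simp flip: elim(1))
    qed
    show "AE x in M. ?E (\<lambda>y. ennreal (- f y) + ennreal (- g y)) x < \<infinity>"
      using b parts(2,4)
    proof eventually_elim
      case (elim x)
      from elim(2,3) show ?case by (simp flip: elim(1))
    qed
  qed auto
  with a b parts show ?thesis
  proof eventually_elim
    case (elim x)
    from elim(3-6) show ?case
      unfolding elim(7) elim(1,2)[symmetric] by (simp add: real_cond_exp_def enn2real_plus)
  qed
qed

text \<open>
  The factor \<open>h\<close> may change sign, so the pull-out property for nonnegative functions is applied to
  the four products in \<open>h f = (h\<^sup>+ f\<^sup>+ + h\<^sup>- f\<^sup>-) - (h\<^sup>+ f\<^sup>- + h\<^sup>- f\<^sup>+)\<close>.
\<close>
lemma real_cond_exp_mult_locally_finite: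
  fixes f h :: "'a \<Rightarrow> real"
  assumes h [measurable]: "h \<in> borel_measurable F" and [measurable]: "f \<in> borel_measurable M"
    and f: "AE x in M. nn_cond_exp M F (\<lambda>y. ennreal \<bar>f y\<bar>) x < \<infinity>"
  shows "AE x in M. real_cond_exp M F (\<lambda>y. h y * f y) x = h x * real_cond_exp M F f x"
proof -
  let ?E = "nn_cond_exp M F"
  have [measurable]: "h \<in> borel_measurable M"
    by (rule measurable_from_subalg[OF subalg h])
  have parts: "AE x in M. ?E (\<lambda>y. ennreal (f y)) x < \<infinity>" "AE x in M. ?E (\<lambda>y. ennreal (- f y)) x < \<infinity>"
    by (rule nn_cond_exp_finite_mono[OF f]; auto intro!: ennreal_leI)+
  define a where "a = (\<lambda>y. ennreal (h y) * ennreal (f y) + ennreal (- h y) * ennreal (- f y))"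
  define b where "b = (\<lambda>y. ennreal (h y) * ennreal (- f y) + ennreal (- h y) * ennreal (f y))"
  have [measurable]: "a \<in> borel_measurable M" "b \<in> borel_measurable M"
    by (auto simp: a_def b_def)
  have Ea: "AE x in M. ?E a x =
      ennreal (h x) * ?E (\<lambda>y. ennreal (f y)) x + ennreal (- h x) * ?E (\<lambda>y. ennreal (- f y)) x"
  proof -
    have "AE x in M. ?E (\<lambda>y. ennreal (h y) * ennreal (f y)) x + ?E (\<lambda>y. ennreal (- h y) * ennreal (- f y)) x = ?E a x"
      unfolding a_def by (rule nn_cond_exp_sum) auto
    moreover have "AE x in M. ennreal (h x) * ?E (\<lambda>y. ennreal (f y)) x = ?E (\<lambda>y. ennreal (h y) * ennreal (f y)) x"
      by (rule nn_cond_exp_prod) auto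
    moreover have "AE x in M. ennreal (- h x) * ?E (\<lambda>y. ennreal (- f y)) x = ?E (\<lambda>y. ennreal (- h y) * ennreal (- f y)) x"
      by (rule nn_cond_exp_prod) auto
    ultimately show ?thesis by eventually_elim simp
  qed
  have Eb: "AE x in M. ?E b x =
      ennreal (h x) * ?E (\<lambda>y. ennreal (- f y)) x + ennreal (- h x) * ?E (\<lambda>y. ennreal (f y)) x"
  proof -
    have "AE x in M. ?E (\<lambda>y. ennreal (h y) * ennreal (- f y)) x + ?E (\<lambda>y. ennreal (- h y) * ennreal (f y)) x = ?E b x"
      unfolding b_def by (rule nn_cond_exp_sum) auto
    moreover have "AE x in M. ennreal (h x) * ?E (\<lambda>y. ennreal (- f y)) x = ?E (\<lambda>y. ennreal (h y) * ennreal (- f y)) x"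
      by (rule nn_cond_exp_prod) auto
    moreover have "AE x in M. ennreal (- h x) * ?E (\<lambda>y. ennreal (f y)) x = ?E (\<lambda>y. ennreal (- h y) * ennreal (f y)) x"
      by (rule nn_cond_exp_prod) auto
    ultimately show ?thesis by eventually_elim simp
  qed
  have "AE x in M. real_cond_exp M F (\<lambda>y. h y * f y) x = enn2real (?E a x) - enn2real (?E b x)"
  proof (rule real_cond_exp_eq_difference)
    fix x
    have "h x \<ge> 0 \<or> h x < 0" "f x \<ge> 0 \<or> f x < 0" by auto
    then show "ennreal (h x * f x) + b x = ennreal (- (h x * f x)) + a x"
      by (elim disjE)
        (auto simp: a_def b_def ennreal_neg mult_nonneg_nonpos mult_nonpos_nonneg mult_nonpos_nonpos
          simp flip: ennreal_mult)
  next
    show "AE x in M. ?E (\<lambda>y. ennreal \<bar>h y * f y\<bar>) x < \<infinity>"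
      using nn_cond_exp_norm_mult_finite[of h f] f by simp
    show "AE x in M. ?E a x < \<infinity>"
      using Ea parts by eventually_elim (simp add: ennreal_mult_less_top)
    show "AE x in M. ?E b x < \<infinity>"
      using Eb parts by eventually_elim (simp add: ennreal_mult_less_top)
  qed auto
  with Ea Eb parts show ?thesis
  proof eventually_elim
    case (elim x)
    have "h x \<ge> 0 \<or> h x < 0" by auto
    then show ?case
      unfolding elim(5) elim(1,2) using elim(3,4)
      by (elim disjE)
        (auto simp: real_cond_exp_def ennreal_neg enn2real_mult algebra_simps)
  qed
qed

end

section \<open>Complex conditional expectation\<close>

lemma borel_measurable_Complex [measurable (raw)]:
  assumes [measurable]: "f \<in> borel_measurable M" "g \<in> borel_measurable M"
  shows "(\<lambda>x. Complex (f x) (g x)) \<in> borel_measurable M"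
  unfolding Complex_eq by measurable

lemma
  shows borel_measurable_complex_cond_exp [measurable]: "complex_cond_exp M F f \<in> borel_measurable F"
    and borel_measurable_complex_cond_exp2 [measurable]: "complex_cond_exp M F f \<in> borel_measurable M"
  unfolding complex_cond_exp_def by measurable

context sigma_finite_subalgebra
begin

lemma complex_cond_exp_cong:
  assumes "AE x in M. f x = g x"
    and [measurable]: "f \<in> borel_measurable M" "g \<in> borel_measurable M"
  shows "AE x in M. complex_cond_exp M F f x = complex_cond_exp M F g x"
proof -
  have "AE x in M. real_cond_exp M F (\<lambda>y. Re (f y)) x = real_cond_exp M F (\<lambda>y. Re (g y)) x"
    by (rule real_cond_exp_cong) (use assms(1) in \<open>auto\<close>)
  moreover have "AE x in M. real_cond_exp M F (\<lambda>y. Im (f y)) x = real_cond_exp M F (\<lambda>y. Im (g y)) x"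
    by (rule real_cond_exp_cong) (use assms(1) in \<open>auto\<close>)
  ultimately show ?thesis
    by eventually_elim (simp add: complex_cond_exp_def)
qed

lemma cond_exp_defined_Re_Im:
  assumes "cond_exp_defined M F f"
  shows "AE x in M. nn_cond_exp M F (\<lambda>y. ennreal \<bar>Re (f y)\<bar>) x < \<infinity>"
    and "AE x in M. nn_cond_exp M F (\<lambda>y. ennreal \<bar>Im (f y)\<bar>) x < \<infinity>"
proof -
  have [measurable]: "f \<in> borel_measurable M"
    and f: "AE x in M. nn_cond_exp M F (\<lambda>y. ennreal (cmod (f y))) x < \<infinity>"
    using assms by (auto simp: cond_exp_defined_def)
  show "AE x in M. nn_cond_exp M F (\<lambda>y. ennreal \<bar>Re (f y)\<bar>) x < \<infinity>"
    by (rule nn_cond_exp_finite_mono[OF f]) (auto intro!: ennreal_leI abs_Re_le_cmod)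
  show "AE x in M. nn_cond_exp M F (\<lambda>y. ennreal \<bar>Im (f y)\<bar>) x < \<infinity>"
    by (rule nn_cond_exp_finite_mono[OF f]) (auto intro!: ennreal_leI abs_Im_le_cmod)
qed

lemma complex_cond_exp_add:
  assumes f: "cond_exp_defined M F f" and g: "cond_exp_defined M F g"
  shows "AE x in M. complex_cond_exp M F (\<lambda>y. f y + g y) x =
    complex_cond_exp M F f x + complex_cond_exp M F g x"
proof -
  have [measurable]: "f \<in> borel_measurable M" "g \<in> borel_measurable M"
    using f g by (auto simp: cond_exp_defined_def)
  note fin = cond_exp_defined_Re_Im[OF f] cond_exp_defined_Re_Im[OF g]
  have "AE x in M. real_cond_exp M F (\<lambda>y. Re (f y) + Re (g y)) x =
      real_cond_exp M F (\<lambda>y. Re (f y)) x + real_cond_exp M F (\<lambda>y. Re (g y)) x"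
    by (rule real_cond_exp_add_locally_finite[OF _ _ fin(1,3)]) auto
  moreover have "AE x in M. real_cond_exp M F (\<lambda>y. Im (f y) + Im (g y)) x =
      real_cond_exp M F (\<lambda>y. Im (f y)) x + real_cond_exp M F (\<lambda>y. Im (g y)) x"
    by (rule real_cond_exp_add_locally_finite[OF _ _ fin(2,4)]) auto
  ultimately show ?thesis
    by eventually_elim (simp add: complex_cond_exp_def complex_eq_iff)
qed

lemma complex_cond_exp_mult:
  assumes h [measurable]: "h \<in> borel_measurable F" and f: "cond_exp_defined M F f"
  shows "AE x in M. complex_cond_exp M F (\<lambda>y. h y * f y) x = h x * complex_cond_exp M F f x"
proof -
  have [measurable]: "f \<in> borel_measurable M"
    using f by (auto simp: cond_exp_defined_def)
  have [measurable]: "h \<in> borel_measurable M"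
    by (rule measurable_from_subalg[OF subalg h])
  note fin = cond_exp_defined_Re_Im[OF f]
  have prod: "AE x in M. real_cond_exp M F (\<lambda>y. r y * s y) x = r x * real_cond_exp M F s x"
      "AE x in M. nn_cond_exp M F (\<lambda>y. ennreal \<bar>r y * s y\<bar>) x < \<infinity>"
    if [measurable]: "r \<in> borel_measurable F" and s: "s = (\<lambda>y. Re (f y)) \<or> s = (\<lambda>y. Im (f y))" for r s
  proof -
    have [measurable]: "s \<in> borel_measurable M"
      using s by auto
    have s: "AE x in M. nn_cond_exp M F (\<lambda>y. ennreal \<bar>s y\<bar>) x < \<infinity>"
      using s fin by (elim disjE; simp only:)
    show "AE x in M. real_cond_exp M F (\<lambda>y. r y * s y) x = r x * real_cond_exp M F s x"
      by (rule real_cond_exp_mult_locally_finite[OF _ _ s]) auto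
    show "AE x in M. nn_cond_exp M F (\<lambda>y. ennreal \<bar>r y * s y\<bar>) x < \<infinity>"
      by (rule nn_cond_exp_norm_mult_finite[of r s, unfolded real_norm_def, OF _ _ s]) auto
  qed
  have "AE x in M. real_cond_exp M F (\<lambda>y. Re (h y) * Re (f y) + (- Im (h y)) * Im (f y)) x =
      real_cond_exp M F (\<lambda>y. Re (h y) * Re (f y)) x + real_cond_exp M F (\<lambda>y. (- Im (h y)) * Im (f y)) x"
    by (rule real_cond_exp_add_locally_finite; (intro prod)?) auto
  moreover have "AE x in M. real_cond_exp M F (\<lambda>y. Re (h y) * Im (f y) + Im (h y) * Re (f y)) x =
      real_cond_exp M F (\<lambda>y. Re (h y) * Im (f y)) x + real_cond_exp M F (\<lambda>y. Im (h y) * Re (f y)) x"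
    by (rule real_cond_exp_add_locally_finite; (intro prod)?) auto
  moreover have "AE x in M. real_cond_exp M F (\<lambda>y. Re (h y) * Re (f y)) x = Re (h x) * real_cond_exp M F (\<lambda>y. Re (f y)) x"
    "AE x in M. real_cond_exp M F (\<lambda>y. (- Im (h y)) * Im (f y)) x = (- Im (h x)) * real_cond_exp M F (\<lambda>y. Im (f y)) x"
    "AE x in M. real_cond_exp M F (\<lambda>y. Re (h y) * Im (f y)) x = Re (h x) * real_cond_exp M F (\<lambda>y. Im (f y)) x"
    "AE x in M. real_cond_exp M F (\<lambda>y. Im (h y) * Re (f y)) x = Im (h x) * real_cond_exp M F (\<lambda>y. Re (f y)) x"
    by (rule prod; simp)+
  ultimately show ?thesis
    by eventually_elim (simp add: complex_cond_exp_def complex_eq_iff)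
qed

end

section \<open>Orlicz spaces are solid vector spaces\<close>

text \<open>A point \<open>x\<close> of \<open>[0, y]\<close> is a convex combination of \<open>0\<close> and \<open>y\<close>, and \<open>\<Phi> 0 = 0\<close>.\<close>
lemma young_function_mono:
  assumes "young_function \<Phi>" "0 \<le> x" "x \<le> y"
  shows "\<Phi> x \<le> \<Phi> y"
proof (cases "y = 0")
  case False
  then have y: "0 < y" using assms by auto
  have conv: "0 \<le> t \<Longrightarrow> t \<le> 1 \<Longrightarrow>
      \<Phi> ((1 - t) * a + t * b) \<le> ennreal (1 - t) * \<Phi> a + ennreal t * \<Phi> b" for a b t
    using assms(1) unfolding young_function_def ennreal_convex_def by blast
  have "\<Phi> x = \<Phi> ((1 - x / y) * 0 + x / y * y)"
    using y by simp
  also have "\<dots> \<le> ennreal (1 - x / y) * \<Phi> 0 + ennreal (x / y) * \<Phi> y"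
    using assms y by (intro conv) auto
  also have "\<dots> \<le> 1 * \<Phi> y"
    using assms y unfolding young_function_def
    by (auto intro!: mult_right_mono simp: ennreal_le_1 simp del: mult_1)
  finally show ?thesis by simp
qed (use assms in auto)

lemma borel_measurable_mono_ennreal:
  fixes g :: "real \<Rightarrow> ennreal"
  assumes "mono g"
  shows "g \<in> borel_measurable borel"
proof (rule borel_measurableI_le)
  fix a
  \<comment> \<open>Sublevel sets are closed downwards, so the indicator of the complement is a monotone real function.\<close>
  define h :: "real \<Rightarrow> real" where "h x = (if g x \<le> a then 0 else 1)" for x
  have "mono h"
    using assms by (auto simp: mono_def h_def intro: order_trans)
  then have [measurable]: "h \<in> borel_measurable borel"
    by (rule borel_measurable_mono)
  have "{x \<in> space borel. h x = 0} \<in> sets borel"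
    by measurable
  also have "{x \<in> space borel. h x = 0} = {x \<in> space borel. g x \<le> a}"
    by (auto simp: h_def)
  finally show "{x \<in> space borel. g x \<le> a} \<in> sets borel" .
qed

text \<open>
  Measurability of \<open>\<Phi>\<close> is what allows the integral over \<open>X\<close> of a sum of two terms
  \<open>\<Phi>(k \<bar>f\<bar>) + \<Phi>(l \<bar>g\<bar>)\<close> to be split.
\<close>
lemma borel_measurable_young_function:
  assumes "young_function \<Phi>"
  shows "\<Phi> \<in> borel_measurable borel"
proof -
  have "mono (\<lambda>x. \<Phi> (max x 0))"
    by (auto simp: mono_def intro!: young_function_mono[OF assms])
  then have [measurable]: "(\<lambda>x. \<Phi> (max x 0)) \<in> borel_measurable borel"
    by (rule borel_measurable_mono_ennreal)
  have "(\<lambda>x. \<Phi> (max \<bar>x\<bar> 0)) \<in> borel_measurable borel"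
    by measurable
  also have "(\<lambda>x. \<Phi> (max \<bar>x\<bar> 0)) = \<Phi>"
    using assms by (auto simp: young_function_def fun_eq_iff abs_if)
  finally show ?thesis .
qed

lemma orlicz_space_dominated:
  assumes \<Phi>: "young_function \<Phi>" and f: "f \<in> orlicz_space M \<Phi>" and g: "g \<in> borel_measurable M"
    and c: "c > 0" and le: "AE x in M. cmod (g x) \<le> c * cmod (f x)"
  shows "g \<in> orlicz_space M \<Phi>"
proof -
  obtain k where k: "k > 0" "(\<integral>\<^sup>+ x. \<Phi> (cmod (of_real k * f x)) \<partial>M) < \<infinity>"
    using f by (auto simp: orlicz_space_def)
  have "(\<integral>\<^sup>+ x. \<Phi> (cmod (of_real (k / c) * g x)) \<partial>M) \<le> (\<integral>\<^sup>+ x. \<Phi> (cmod (of_real k * f x)) \<partial>M)"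
  proof (rule nn_integral_mono_AE, use le in eventually_elim)
    case (elim x)
    have "cmod (of_real (k / c) * g x) \<le> cmod (of_real k * f x)"
      using mult_left_mono[OF elim, of "k / c"] k c by (simp add: norm_mult norm_divide)
    then show ?case
      by (intro young_function_mono[OF \<Phi>]) auto
  qed
  with k c g show ?thesis
    unfolding orlicz_space_def by (auto intro!: exI[of _ "k / c"])
qed

lemma orlicz_space_add:
  assumes \<Phi>: "young_function \<Phi>" and f: "f \<in> orlicz_space M \<Phi>" and g: "g \<in> orlicz_space M \<Phi>"
  shows "(\<lambda>x. f x + g x) \<in> orlicz_space M \<Phi>"
proof -
  note [measurable] = borel_measurable_young_function[OF \<Phi>]
  obtain k where k: "k > 0" "(\<integral>\<^sup>+ x. \<Phi> (cmod (of_real k * f x)) \<partial>M) < \<infinity>"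
    using f by (auto simp: orlicz_space_def)
  obtain l where l: "l > 0" "(\<integral>\<^sup>+ x. \<Phi> (cmod (of_real l * g x)) \<partial>M) < \<infinity>"
    using g by (auto simp: orlicz_space_def)
  have [measurable]: "f \<in> borel_measurable M" "g \<in> borel_measurable M"
    using f g by (auto simp: orlicz_space_def)
  \<comment> \<open>The factor one half writes \<open>j (f + g)\<close> as a midpoint, so that convexity applies.\<close>
  define j where "j = min k l / 2"
  have "(\<integral>\<^sup>+ x. \<Phi> (cmod (of_real j * (f x + g x))) \<partial>M)
      \<le> (\<integral>\<^sup>+ x. \<Phi> (cmod (of_real k * f x)) + \<Phi> (cmod (of_real l * g x)) \<partial>M)"
  proof (rule nn_integral_mono)
    fix x
    have conv: "\<Phi> ((1 - 1/2) * a + (1/2) * b) \<le> ennreal (1 - 1/2) * \<Phi> a + ennreal (1/2) * \<Phi> b" for a b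
    proof -
      have "0 \<le> (1/2::real) \<and> (1/2::real) \<le> 1" by simp
      then show ?thesis
        using \<Phi> unfolding young_function_def ennreal_convex_def by blast
    qed
    have "min k l * cmod (f x + g x) \<le> min k l * (cmod (f x) + cmod (g x))"
      using k l by (intro mult_left_mono norm_triangle_ineq) auto
    also have "\<dots> \<le> k * cmod (f x) + l * cmod (g x)"
      unfolding distrib_left by (intro add_mono mult_right_mono) auto
    finally have "cmod (of_real j * (f x + g x)) \<le>
        (1 - 1/2) * cmod (of_real k * f x) + (1/2) * cmod (of_real l * g x)"
      using k l by (simp add: norm_mult j_def)
    then have "\<Phi> (cmod (of_real j * (f x + g x)))
        \<le> \<Phi> ((1 - 1/2) * cmod (of_real k * f x) + (1/2) * cmod (of_real l * g x))"
      by (intro young_function_mono[OF \<Phi>]) auto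
    also have "\<dots> \<le> ennreal (1 - 1/2) * \<Phi> (cmod (of_real k * f x)) + ennreal (1/2) * \<Phi> (cmod (of_real l * g x))"
      by (rule conv)
    also have "\<dots> \<le> 1 * \<Phi> (cmod (of_real k * f x)) + 1 * \<Phi> (cmod (of_real l * g x))"
      by (intro add_mono mult_right_mono) (auto simp only: ennreal_le_1 zero_le)
    finally show "\<Phi> (cmod (of_real j * (f x + g x)))
        \<le> \<Phi> (cmod (of_real k * f x)) + \<Phi> (cmod (of_real l * g x))" by simp
  qed
  also have "\<dots> = (\<integral>\<^sup>+ x. \<Phi> (cmod (of_real k * f x)) \<partial>M) + (\<integral>\<^sup>+ x. \<Phi> (cmod (of_real l * g x)) \<partial>M)"
    by (rule nn_integral_add) auto
  also have "\<dots> < \<infinity>"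
    using k l by simp
  finally show ?thesis
    using k l unfolding orlicz_space_def by (auto simp: j_def intro!: exI[of _ j])
qed

lemma orlicz_space_diff:
  assumes \<Phi>: "young_function \<Phi>" and f: "f \<in> orlicz_space M \<Phi>" and g: "g \<in> orlicz_space M \<Phi>"
  shows "(\<lambda>x. f x - g x) \<in> orlicz_space M \<Phi>"
proof -
  have "(\<lambda>x. - g x) \<in> orlicz_space M \<Phi>"
    by (rule orlicz_space_dominated[OF \<Phi> g, of _ 1]) (use g in \<open>auto simp: orlicz_space_def\<close>)
  from orlicz_space_add[OF \<Phi> f this] show ?thesis by simp
qed

lemma orlicz_zero_subset_orlicz_space:
  assumes "young_function \<Phi>"
  shows "orlicz_zero M \<subseteq> orlicz_space M \<Phi>"
proof
  fix f :: "'a \<Rightarrow> complex" assume f: "f \<in> orlicz_zero M"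
  have "(\<lambda>_. 0) \<in> orlicz_space M \<Phi>"
    using assms by (auto simp: orlicz_space_def young_function_def intro!: exI[of _ 1])
  then show "f \<in> orlicz_space M \<Phi>"
    by (rule orlicz_space_dominated[OF assms, of _ _ _ 1]) (use f in \<open>auto simp: orlicz_zero_def\<close>)
qed

section \<open>Powers of a weighted conditional type operator\<close>

locale bounded_wct_operator = sigma_finite_subalgebra M F
  for M F :: "'a measure" +
  fixes \<Phi> :: "real \<Rightarrow> ennreal" and w u :: "'a \<Rightarrow> complex"
  assumes young: "young_function \<Phi>"
    and defined: "wct_defined M F \<Phi> w u"
    and bounded: "bounded_on_orlicz M \<Phi> (wct M F w u)"
begin

abbreviation L :: "('a \<Rightarrow> complex) set" where "L \<equiv> orlicz_space M \<Phi>"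
abbreviation T :: "('a \<Rightarrow> complex) \<Rightarrow> 'a \<Rightarrow> complex" where "T \<equiv> wct M F w u"
abbreviation Eu :: "('a \<Rightarrow> complex) \<Rightarrow> 'a \<Rightarrow> complex"
  where "Eu f \<equiv> complex_cond_exp M F (\<lambda>y. u y * f y)"
abbreviation v :: "'a \<Rightarrow> complex" where "v \<equiv> complex_cond_exp M F (\<lambda>y. w y * u y)"

lemma borel_measurable_weights [measurable]:
  "w \<in> borel_measurable M" "u \<in> borel_measurable M"
  using defined by (auto simp: wct_defined_def)

lemma borel_measurable_orlicz: "f \<in> L \<Longrightarrow> f \<in> borel_measurable M"
  by (simp add: orlicz_space_def)

lemma funpow_in_orlicz: "f \<in> L \<Longrightarrow> (T ^^ n) f \<in> L"
  using bounded by (induction n) (auto simp: bounded_on_orlicz_def)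

lemma Eu_cong:
  assumes "f \<in> L" "g \<in> L" "AE x in M. f x = g x"
  shows "AE x in M. Eu f x = Eu g x"
  using assms by (intro complex_cond_exp_cong) (auto dest!: borel_measurable_orlicz)

lemma Eu_add:
  assumes "f \<in> L" "g \<in> L"
  shows "AE x in M. Eu (\<lambda>y. f y + g y) x = Eu f x + Eu g x"
  using assms defined complex_cond_exp_add[of "\<lambda>y. u y * f y" "\<lambda>y. u y * g y"]
  by (simp add: wct_defined_def distrib_left)

lemma Eu_mult:
  assumes "f \<in> L" "h \<in> borel_measurable F"
  shows "AE x in M. Eu (\<lambda>y. h y * f y) x = h x * Eu f x"
  using assms defined complex_cond_exp_mult[of h "\<lambda>y. u y * f y"]
  by (simp add: wct_defined_def mult.left_commute)

text \<open>Although \<open>T\<close> acts on representatives, it descends to classes modulo equality almost everywhere.\<close>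
lemma funpow_cong:
  assumes "f \<in> L" "g \<in> L" "AE x in M. f x = g x"
  shows "AE x in M. (T ^^ n) f x = (T ^^ n) g x"
proof (induction n)
  case (Suc n)
  show ?case
    using Eu_cong[OF funpow_in_orlicz funpow_in_orlicz Suc] assms
    by (auto simp: wct_def)
qed (use assms in simp)

text \<open>
  Applying \<open>T\<close> to \<open>w * v ^ n * E(u f)\<close> produces \<open>w * E(u w * (v ^ n * E(u f)))\<close>; the last two factors
  are measurable for the subalgebra and can be pulled out, which leaves one more factor
  \<open>E(u w) = v\<close>.
\<close>
lemma funpow_eq:
  assumes f: "f \<in> L"
  shows "AE x in M. (T ^^ Suc n) f x = w x * v x ^ n * Eu f x"
proof (induction n)
  case 0
  show ?case by (simp add: wct_def)
next
  case (Suc n)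
  have [measurable]: "(T ^^ Suc n) f \<in> borel_measurable M" "f \<in> borel_measurable M"
    using funpow_in_orlicz[OF f] f by (auto intro: borel_measurable_orlicz simp del: funpow.simps)
  have vE: "(\<lambda>x. v x ^ n * Eu f x) \<in> borel_measurable F"
    by measurable
  have "AE x in M. Eu ((T ^^ Suc n) f) x =
      complex_cond_exp M F (\<lambda>y. (v y ^ n * Eu f y) * (w y * u y)) x"
  proof (rule complex_cond_exp_cong)
    show "AE x in M. u x * (T ^^ Suc n) f x = (v x ^ n * Eu f x) * (w x * u x)"
      using Suc by eventually_elim (simp del: funpow.simps)
  qed measurable
  moreover have "AE x in M. complex_cond_exp M F (\<lambda>y. (v y ^ n * Eu f y) * (w y * u y)) x
      = (v x ^ n * Eu f x) * v x"
    using defined by (intro complex_cond_exp_mult[OF vE]) (simp add: wct_defined_def mult.commute)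
  ultimately show ?case
  proof eventually_elim
    case (elim x)
    have "(T ^^ Suc (Suc n)) f x = w x * Eu ((T ^^ Suc n) f) x"
      by (simp add: wct_def)
    also have "\<dots> = w x * v x ^ Suc n * Eu f x"
      by (simp only: elim) simp
    finally show ?case .
  qed
qed

lemma square_eq:
  assumes "f \<in> L"
  shows "AE x in M. (T ^^ 2) f x = w x * v x * Eu f x"
  using funpow_eq[OF assms, of 1] by (simp add: numeral_2_eq_2)

lemma square_add:
  assumes f: "f \<in> L" and g: "g \<in> L"
  shows "AE x in M. (T ^^ 2) (\<lambda>y. f y + g y) x = (T ^^ 2) f x + (T ^^ 2) g x"
  using square_eq[OF f] square_eq[OF g] square_eq[OF orlicz_space_add[OF young f g]] Eu_add[OF f g]
  by eventually_elim (simp add: distrib_left)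

section \<open>Range and null space of the powers\<close>

text \<open>
  For \<open>g = T\<^sup>2 f\<close> the value of \<open>T ^ m g\<close> is \<open>w v ^ (m + 1) E(u f)\<close>, while \<open>g = w v E(u f)\<close>. These
  two products have the same distinct factors, hence the same zeros. The square is essential:
  \<open>w E(u f)\<close> lacks the factor \<open>v\<close> and may be nonzero where \<open>v\<close> vanishes.
\<close>
lemma range_square_Int_null_space:
  assumes m: "m \<ge> 1"
  shows "range_space M \<Phi> (T ^^ 2) \<inter> null_space M \<Phi> (T ^^ m) = orlicz_zero M"
proof (intro subset_antisym subsetI)
  fix g assume g: "g \<in> range_space M \<Phi> (T ^^ 2) \<inter> null_space M \<Phi> (T ^^ m)"
  then obtain f where gL: "g \<in> L" and f: "f \<in> L" and gf: "AE x in M. g x = (T ^^ 2) f x"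
    and Tg: "AE x in M. (T ^^ m) g x = 0"
    by (auto simp: range_space_def null_space_def)
  have "(T ^^ m) ((T ^^ 2) f) = (T ^^ Suc (m + 1)) f"
    using funpow_add[of m 2 T] by (simp add: o_def)
  with funpow_cong[OF gL funpow_in_orlicz[OF f] gf, of m]
  have "AE x in M. (T ^^ m) g x = (T ^^ Suc (m + 1)) f x"
    by (simp only:)
  then have "AE x in M. g x = 0"
    using Tg gf square_eq[OF f] funpow_eq[OF f, of "m + 1"]
    by eventually_elim auto
  with gL show "g \<in> orlicz_zero M"
    by (simp add: orlicz_zero_def borel_measurable_orlicz)
next
  fix g :: "'a \<Rightarrow> complex" assume g: "g \<in> orlicz_zero M"
  then have gL: "g \<in> L" and g0: "AE x in M. g x = 0"
    using orlicz_zero_subset_orlicz_space[OF young] by (auto simp: orlicz_zero_def)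
  have [measurable]: "g \<in> borel_measurable M" by (rule borel_measurable_orlicz[OF gL])
  have E0: "AE x in M. Eu g x = 0"
  proof -
    have "AE x in M. Eu g x = Eu (\<lambda>y. 0 * g y) x"
      by (rule complex_cond_exp_cong) (use g0 in auto)
    moreover have "AE x in M. Eu (\<lambda>y. 0 * g y) x = 0 * Eu g x"
      by (rule Eu_mult[OF gL]) simp
    ultimately show ?thesis by eventually_elim simp
  qed
  have zero: "AE x in M. (T ^^ Suc n) g x = 0" for n
    using funpow_eq[OF gL, of n] E0 by eventually_elim simp
  obtain n where "m = Suc n" using m by (cases m) auto
  with zero[of n] zero[of 1] g0 gL
  show "g \<in> range_space M \<Phi> (T ^^ 2) \<inter> null_space M \<Phi> (T ^^ m)"
    by (auto simp: range_space_def null_space_def numeral_2_eq_2 simp del: funpow.simps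
        intro!: bexI[of _ g])
qed

text \<open>
  A summand \<open>h\<close> in the kernel of \<open>T\<^sup>2\<close> is invisible to \<open>T\<^sup>2\<close>, so a decomposition \<open>f = T ^ n g + h\<close> is the
  same as a solution \<open>g\<close> of \<open>T\<^sup>2 f = T ^ (n + 2) g\<close>.
\<close>
lemma orlicz_eq_range_plus_null_iff:
  "L = fun_set_sum (range_space M \<Phi> (T ^^ n)) (null_space M \<Phi> (T ^^ 2)) \<longleftrightarrow>
   (\<forall>f\<in>L. \<exists>g\<in>L. AE x in M. (T ^^ 2) f x = (T ^^ 2) ((T ^^ n) g) x)"
    (is "L = ?S \<longleftrightarrow> _")
proof (intro iffI ballI)
  fix f assume "L = ?S" "f \<in> L"
  then have "f \<in> ?S" by simp
  then obtain r h g where f: "f = (\<lambda>x. r x + h x)" and L: "r \<in> L" "h \<in> L" "g \<in> L"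
    and r: "AE x in M. r x = (T ^^ n) g x" and h: "AE x in M. (T ^^ 2) h x = 0"
    by (auto simp: fun_set_sum_def range_space_def null_space_def)
  have "AE x in M. (T ^^ 2) f x = (T ^^ 2) ((T ^^ n) g) x"
    using square_add[OF L(1,2)] h funpow_cong[OF L(1) funpow_in_orlicz[OF L(3)] r, of 2]
    unfolding f by eventually_elim simp
  with L show "\<exists>g\<in>L. AE x in M. (T ^^ 2) f x = (T ^^ 2) ((T ^^ n) g) x" by blast
next
  assume solve: "\<forall>f\<in>L. \<exists>g\<in>L. AE x in M. (T ^^ 2) f x = (T ^^ 2) ((T ^^ n) g) x"
  show "L = ?S"
  proof (intro subset_antisym subsetI)
    fix f assume f: "f \<in> L"
    with solve obtain g where g: "g \<in> L" and fg: "AE x in M. (T ^^ 2) f x = (T ^^ 2) ((T ^^ n) g) x"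
      by blast
    define r h where "r = (T ^^ n) g" and "h = (\<lambda>x. f x - r x)"
    have r: "r \<in> L" unfolding r_def by (rule funpow_in_orlicz[OF g])
    have h: "h \<in> L" unfolding h_def by (rule orlicz_space_diff[OF young f r])
    have f_eq: "f = (\<lambda>x. r x + h x)" by (simp add: h_def)
    have "AE x in M. (T ^^ 2) h x = 0"
      using square_add[OF r h] fg unfolding f_eq[symmetric] r_def[symmetric]
      by eventually_elim simp
    with h have "h \<in> null_space M \<Phi> (T ^^ 2)"
      by (simp add: null_space_def)
    moreover have "r \<in> range_space M \<Phi> (T ^^ n)"
      using r g by (auto simp: range_space_def r_def)
    ultimately show "f \<in> ?S"
      unfolding fun_set_sum_def using f_eq by blast
  next
    fix f assume "f \<in> ?S"
    then show "f \<in> L"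
      by (auto simp: fun_set_sum_def range_space_def null_space_def intro!: orlicz_space_add[OF young])
  qed
qed

text \<open>
  If \<open>v\<close> is bounded away from zero, then \<open>g = f / v\<close> is again in the Orlicz space, and
  \<open>T\<^sup>3 g = w v\<^sup>2 E(u f) / v = T\<^sup>2 f\<close> because the factor \<open>1 / v\<close> can be pulled out.
\<close>
lemma orlicz_eq_range_plus_null:
  assumes "bounded_away_from_zero M v"
  shows "L = fun_set_sum (range_space M \<Phi> (T ^^ 1)) (null_space M \<Phi> (T ^^ 2))"
  unfolding orlicz_eq_range_plus_null_iff
proof (rule ballI)
  fix f assume f: "f \<in> L"
  obtain \<delta> where \<delta>: "\<delta> > 0" "AE x in M. \<delta> \<le> cmod (v x)"
    using assms by (auto simp: bounded_away_from_zero_def)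
  have [measurable]: "f \<in> borel_measurable M" by (rule borel_measurable_orlicz[OF f])
  define g where "g = (\<lambda>x. inverse (v x) * f x)"
  have g: "g \<in> L"
  proof (rule orlicz_space_dominated[OF young f])
    show "inverse \<delta> > 0" using \<delta> by simp
    show "AE x in M. cmod (g x) \<le> inverse \<delta> * cmod (f x)"
      using \<delta>(2)
    proof eventually_elim
      case (elim x)
      with \<delta>(1) have "inverse (cmod (v x)) \<le> inverse \<delta>"
        by (intro le_imp_inverse_le)
      then show ?case
        by (simp add: g_def norm_mult norm_inverse mult_right_mono)
    qed
  qed (simp add: g_def)
  have "AE x in M. Eu g x = inverse (v x) * Eu f x"
    unfolding g_def by (rule Eu_mult[OF f]) measurable
  then have "AE x in M. (T ^^ 2) f x = (T ^^ Suc 2) g x"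
    using square_eq[OF f] funpow_eq[OF g, of 2] \<delta>(2)
  proof eventually_elim
    case (elim x)
    then have "v x \<noteq> 0" using \<delta>(1) by auto
    then show ?case
      unfolding elim(1-3) by (simp add: power2_eq_square)
  qed
  moreover have "(T ^^ 2) ((T ^^ 1) g) = (T ^^ Suc 2) g"
    by (simp add: numeral_2_eq_2)
  ultimately show "\<exists>g\<in>L. AE x in M. (T ^^ 2) f x = (T ^^ 2) ((T ^^ 1) g) x"
    using g by (intro bexI[of _ g]) (simp_all only:)
qed

text \<open>
  Every decomposition with exponent at least one is also one with exponent exactly one, since
  \<open>T ^ n g = T (T ^ (n - 1) g)\<close>. Conversely, solving \<open>T\<^sup>2 g = T\<^sup>3 g'\<close> and applying \<open>T ^ n\<close> turns a
  solution \<open>g\<close> of \<open>T\<^sup>2 f = T ^ (n + 2) g\<close> into a solution \<open>g'\<close> of \<open>T\<^sup>2 f = T ^ (n + 3) g'\<close>.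
\<close>
lemma orlicz_eq_range_plus_null_independent:
  assumes n: "n \<ge> 1" "L = fun_set_sum (range_space M \<Phi> (T ^^ n)) (null_space M \<Phi> (T ^^ 2))"
  shows "L = fun_set_sum (range_space M \<Phi> (T ^^ m)) (null_space M \<Phi> (T ^^ 2))"
  unfolding orlicz_eq_range_plus_null_iff
proof -
  have add: "(T ^^ a) ((T ^^ b) g) = (T ^^ (a + b)) g" for a b g
    by (simp add: funpow_add)
  have one: "\<exists>g\<in>L. AE x in M. (T ^^ 2) f x = (T ^^ 3) g x" if f: "f \<in> L" for f
  proof -
    obtain g where g: "g \<in> L" "AE x in M. (T ^^ 2) f x = (T ^^ 2) ((T ^^ n) g) x"
      using n(2) f unfolding orlicz_eq_range_plus_null_iff by blast
    have "(T ^^ 2) ((T ^^ n) g) = (T ^^ 3) ((T ^^ (n - 1)) g)"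
      using n(1) by (simp add: add del: funpow.simps)
    with g funpow_in_orlicz[OF g(1), of "n - 1"] show ?thesis by auto
  qed
  show "\<forall>f\<in>L. \<exists>g\<in>L. AE x in M. (T ^^ 2) f x = (T ^^ 2) ((T ^^ m) g) x"
  proof (induction m)
    case (Suc m)
    show ?case
    proof
      fix f assume "f \<in> L"
      with Suc obtain g where g: "g \<in> L" and fg: "AE x in M. (T ^^ 2) f x = (T ^^ 2) ((T ^^ m) g) x"
        by blast
      from one[OF g] obtain g' where g': "g' \<in> L" and gg': "AE x in M. (T ^^ 2) g x = (T ^^ 3) g' x"
        by blast
      have "(T ^^ m) ((T ^^ 2) g) = (T ^^ 2) ((T ^^ m) g)"
        "(T ^^ m) ((T ^^ 3) g') = (T ^^ 2) ((T ^^ Suc m) g')"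
        unfolding add by (simp_all only: add.commute add_Suc_right numeral_3_eq_3 numeral_2_eq_2 add_0 add_0_right add_Suc)
      with funpow_cong[OF funpow_in_orlicz[OF g] funpow_in_orlicz[OF g'] gg', of m]
      have "AE x in M. (T ^^ 2) ((T ^^ m) g) x = (T ^^ 2) ((T ^^ Suc m) g') x"
        by (simp only:)
      with fg have "AE x in M. (T ^^ 2) f x = (T ^^ 2) ((T ^^ Suc m) g') x"
        by eventually_elim (simp only:)
      with g' show "\<exists>g\<in>L. AE x in M. (T ^^ 2) f x = (T ^^ 2) ((T ^^ Suc m) g) x" by blast
    qed
  qed auto
qed

end

theorem proposition2p12:
  fixes M F :: "'a measure"
    and \<Phi> :: "real \<Rightarrow> ennreal"
    and w u :: "'a \<Rightarrow> complex"
    and T :: "('a \<Rightarrow> complex) \<Rightarrow> 'a \<Rightarrow> complex"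
  assumes "complete_measure M"
    and "sigma_finite_measure M"
    and "sigma_finite_subalgebra M F"
    and "young_function \<Phi>"
    and "wct_defined M F \<Phi> w u"
    and "T = wct M F w u"
    and "bounded_on_orlicz M \<Phi> T"
  shows "(\<forall>m\<ge>1. range_space M \<Phi> (T ^^ 2) \<inter> null_space M \<Phi> (T ^^ m) = orlicz_zero M) \<and>
    (bounded_away_from_zero M (complex_cond_exp M F (\<lambda>x. w x * u x)) \<longrightarrow>
       (\<exists>n\<ge>1. orlicz_space M \<Phi> =
          fun_set_sum (range_space M \<Phi> (T ^^ n)) (null_space M \<Phi> (T ^^ 2)))) \<and>
    ((\<exists>n\<ge>1. orlicz_space M \<Phi> =
          fun_set_sum (range_space M \<Phi> (T ^^ n)) (null_space M \<Phi> (T ^^ 2))) \<longleftrightarrow>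
     (\<forall>n\<ge>1. orlicz_space M \<Phi> =
          fun_set_sum (range_space M \<Phi> (T ^^ n)) (null_space M \<Phi> (T ^^ 2))))"
proof -
  interpret sigma_finite_subalgebra M F by fact
  interpret bounded_wct_operator M F \<Phi> w u
    using assms(4-7) by unfold_locales simp_all
  show ?thesis
    unfolding assms(6)
    using range_square_Int_null_space orlicz_eq_range_plus_null orlicz_eq_range_plus_null_independent
    by (intro conjI impI allI iffI) blast+
qed

end
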